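(* Fix a prompt (condition) $c$. Let $p_\theta(\mathbf{x}_{0:T}\mid c)=p(\mathbf{x}_T)\prod_{t=1}^{T}p_\theta(\mathbf{x}_{t-1}\mid\mathbf{x}_t,c)$ be the joint density of trajectories $\mathbf{x}_{0:T}=(\mathbf{x}_0,\dots,\mathbf{x}_T)$ under a policy with parameters $\theta$, where the prior $p(\mathbf{x}_T)$ does not depend on $\theta$. Let $p_{\theta_{\mathrm{old}}}(\mathbf{x}_{0:T}\mid c)$ be the trajectory density of the old policy, of the same form with parameters $\theta_{\mathrm{old}}$, and let $\mathcal{A}(\mathbf{x}_0,c)\in\mathbb{R}$ be an advantage evaluated at the final sample $\mathbf{x}_0$; both $p_{\theta_{\mathrm{old}}}$ and $\mathcal{A}$ are held fixed within an update. Consider the policy gradient (REINFORCE) $$\nabla_\theta\mathcal{J}(\theta)=\mathbb{E}_{\mathbf{x}_{0:T}\sim p_\theta(\cdot\mid c)}\Big[\sum_{t=1}^{T}\nabla_\theta\log p_\theta(\mathbf{x}_{t-1}\mid\mathbf{x}_t,c)\,\mathcal{A}(\mathbf{x}_0,c)\Big]$$ and the target distribution induced by the advantage on the same trajectory space, $$p_{\mathcal{A}}(\mathbf{x}_{0:T}\mid c)=\frac{1}{Z_{\mathcal{A}}(c)}\,p_{\theta_{\mathrm{old}}}(\mathbf{x}_{0:T}\mid c)\exp\big(\mathcal{A}(\mathbf{x}_0,c)\big),\qquad Z_{\mathcal{A}}(c)=\int p_{\theta_{\mathrm{old}}}(\mathbf{x}_{0:T}\mid c)\exp\big(\mathcal{A}(\mathbf{x}_0,c)\big)\,\mathrm{d}\mathbf{x}_{0:T}.$$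 Then the gradient satisfies $$\nabla_\theta\mathcal{J}(\theta)=\nabla_\theta\Big(-D_{\mathrm{KL}}\big(p_\theta(\mathbf{x}_{0:T}\mid c)\,\|\,p_{\mathcal{A}}(\mathbf{x}_{0:T}\mid c)\big)+D_{\mathrm{KL}}\big(p_\theta(\mathbf{x}_{0:T}\mid c)\,\|\,p_{\theta_{\mathrm{old}}}(\mathbf{x}_{0:T}\mid c)\big)\Big).$$
   Context: $D_{\mathrm{KL}}(p\,\|\,q)=\int p\log(p/q)$ is the Kullback–Leibler divergence between densities on trajectory space. On the right-hand side $\nabla_\theta$ acts only through $p_\theta$, since $p_{\mathcal{A}}$ and $p_{\theta_{\mathrm{old}}}$ are fixed. In the flow-model setting of interest, $\mathbf{x}_t\in\mathbb{R}^d$, the transitions $p_\theta(\mathbf{x}_{t-1}\mid\mathbf{x}_t,c)$ are Gaussian densities whose mean depends on $\theta$ and whose covariance is fixed by a noise schedule, and $p(\mathbf{x}_T)$ is the standard Gaussian.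
   Formalization: Added: transition densities are everywhere positive and differentiable in θ, Z_A is finite, both KL divergences are finite for parameters near θ, and the trajectory density times score times advantage is dominated near θ by an integrable function; otherwise the identity can fail. *)

theory Defs
  imports "HOL-Probability.Probability"
begin

(* Encoding: a trajectory (x_0, ..., x_T) is a function x on {0..T}; its reference measure is the
   (T+1)-fold product of Lebesgue measure.  A policy is a family p of transition densities, where
   p \<theta> t y x c stands for p_\<theta>(x_{t-1} = y | x_t = x, c). *)

type_synonym ('q, 'a, 'c) policy = "'q \<Rightarrow> nat \<Rightarrow> 'a \<Rightarrow> 'a \<Rightarrow> 'c \<Rightarrow> real"

definition traj_space :: "nat \<Rightarrow> (nat \<Rightarrow> 'a::euclidean_space) measure" where
  "traj_space T = (\<Pi>\<^sub>M t\<in>{0..T}. lborel)"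

definition prob_density :: "'b measure \<Rightarrow> ('b \<Rightarrow> real) \<Rightarrow> bool" where
  "prob_density M f \<longleftrightarrow>
     f \<in> borel_measurable M \<and> (\<forall>x\<in>space M. 0 \<le> f x) \<and> (\<integral>\<^sup>+ x. ennreal (f x) \<partial>M) = 1"

(* Meaningful where f is differentiable: see grad_eqI and GDERIV_grad. *)
definition grad :: "('q::euclidean_space \<Rightarrow> real) \<Rightarrow> 'q \<Rightarrow> 'q" where
  "grad f \<theta> = (THE D. GDERIV f \<theta> :> D)"

(* The value is meaningful only if the integrand is integrable; it agrees with the library's
   KL_divergence, see kl_div_eq_KL_divergence. *)
definition kl_div :: "'b measure \<Rightarrow> ('b \<Rightarrow> real) \<Rightarrow> ('b \<Rightarrow> real) \<Rightarrow> real" where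
  "kl_div M p q = (\<integral>x. p x * ln (p x / q x) \<partial>M)"

definition kl_finite :: "'b measure \<Rightarrow> ('b \<Rightarrow> real) \<Rightarrow> ('b \<Rightarrow> real) \<Rightarrow> bool" where
  "kl_finite M p q \<longleftrightarrow> integrable M (\<lambda>x. p x * ln (p x / q x))"

definition traj_density ::
    "nat \<Rightarrow> ('a \<Rightarrow> real) \<Rightarrow> ('q, 'a, 'c) policy \<Rightarrow> 'c \<Rightarrow> 'q \<Rightarrow> (nat \<Rightarrow> 'a) \<Rightarrow> real" where
  "traj_density T prior p c \<theta> x = prior (x T) * (\<Prod>t=1..T. p \<theta> t (x (t - 1)) (x t) c)"

definition partition_const ::
    "nat \<Rightarrow> ('a::euclidean_space \<Rightarrow> real) \<Rightarrow> ('q, 'a, 'c) policy \<Rightarrow> ('a \<Rightarrow> 'c \<Rightarrow> real)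
      \<Rightarrow> 'c \<Rightarrow> 'q \<Rightarrow> real" where
  "partition_const T prior p A c \<theta>old =
     (\<integral>x. traj_density T prior p c \<theta>old x * exp (A (x 0) c) \<partial>traj_space T)"

definition target_density ::
    "nat \<Rightarrow> ('a::euclidean_space \<Rightarrow> real) \<Rightarrow> ('q, 'a, 'c) policy \<Rightarrow> ('a \<Rightarrow> 'c \<Rightarrow> real)
      \<Rightarrow> 'c \<Rightarrow> 'q \<Rightarrow> (nat \<Rightarrow> 'a) \<Rightarrow> real" where
  "target_density T prior p A c \<theta>old x =
     1 / partition_const T prior p A c \<theta>old * traj_density T prior p c \<theta>old x * exp (A (x 0) c)"

definition reinforce_integrand ::
    "nat \<Rightarrow> ('q::euclidean_space, 'a, 'c) policy \<Rightarrow> ('a \<Rightarrow> 'c \<Rightarrow> real)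
      \<Rightarrow> 'c \<Rightarrow> 'q \<Rightarrow> (nat \<Rightarrow> 'a) \<Rightarrow> 'q" where
  "reinforce_integrand T p A c \<theta> x =
     (\<Sum>t=1..T. A (x 0) c *\<^sub>R grad (\<lambda>\<theta>'. ln (p \<theta>' t (x (t - 1)) (x t) c)) \<theta>)"

definition policy_gradient ::
    "nat \<Rightarrow> ('a::euclidean_space \<Rightarrow> real) \<Rightarrow> ('q::euclidean_space, 'a, 'c) policy
      \<Rightarrow> ('a \<Rightarrow> 'c \<Rightarrow> real) \<Rightarrow> 'c \<Rightarrow> 'q \<Rightarrow> 'q" where
  "policy_gradient T prior p A c \<theta> =
     (\<integral>x. reinforce_integrand T p A c \<theta> x
        \<partial>density (traj_space T) (\<lambda>x. ennreal (traj_density T prior p c \<theta> x)))"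

lemma grad_eqI:
  assumes "GDERIV f \<theta> :> D"
  shows "grad f \<theta> = D"
  unfolding grad_def
proof (rule the_equality[where P = "\<lambda>D. GDERIV f \<theta> :> D", OF assms])
  fix D' assume "GDERIV f \<theta> :> D'"
  with assms have "(\<lambda>h. h \<bullet> D') = (\<lambda>h. h \<bullet> D)"
    unfolding gderiv_def by (rule has_derivative_unique[rotated])
  then show "D' = D"
    by (metis vector_eq_ldot)
qed

lemma GDERIV_grad:
  fixes f :: "'q::euclidean_space \<Rightarrow> real"
  assumes "f differentiable (at \<theta>)"
  shows "GDERIV f \<theta> :> grad f \<theta>"
proof -
  from assms obtain f' where f': "(f has_derivative f') (at \<theta>)"
    unfolding differentiable_def by blast
  then interpret bounded_linear f' by (rule has_derivative_bounded_linear)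
  define D where "D = (\<Sum>b\<in>Basis. f' b *\<^sub>R b)"
  have "f' h = h \<bullet> D" for h
  proof -
    have "f' h = f' (\<Sum>b\<in>Basis. (h \<bullet> b) *\<^sub>R b)" by (simp add: euclidean_representation)
    also have "\<dots> = (\<Sum>b\<in>Basis. (h \<bullet> b) * f' b)" by (simp add: sum scaleR)
    also have "\<dots> = h \<bullet> D" by (simp add: D_def inner_sum_right mult.commute)
    finally show ?thesis .
  qed
  then have "f' = (\<lambda>h. h \<bullet> D)" by blast
  with f' have "GDERIV f \<theta> :> D" by (simp add: gderiv_def)
  then show ?thesis by (simp add: grad_eqI)
qed

lemma kl_div_eq_KL_divergence:
  assumes "sigma_finite_measure M"
    and "p \<in> borel_measurable M" "AE x in M. 0 \<le> p x"
    and "q \<in> borel_measurable M" "AE x in M. 0 \<le> q x"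
    and "AE x in M. q x = 0 \<longrightarrow> p x = 0"
  shows "kl_div M p q = KL_divergence (exp 1) (density M q) (density M p)"
  unfolding kl_div_def
  by (subst sigma_finite_measure.KL_density_density[OF assms(1)]) (use assms in \<open>simp_all add: log_def\<close>)

(* Isotropic Gaussian transitions with parametrised mean and scheduled variance meet the positivity,
   normalisation, measurability and differentiability requirements on a policy. *)

definition gauss_density :: "'a::euclidean_space \<Rightarrow> real \<Rightarrow> 'a \<Rightarrow> real" where
  "gauss_density m \<sigma> y = (\<Prod>b\<in>Basis. normal_density (m \<bullet> b) \<sigma> (y \<bullet> b))"

lemma gauss_density_pos: "0 < \<sigma> \<Longrightarrow> 0 < gauss_density m \<sigma> y"
  unfolding gauss_density_def by (intro prod_pos) (simp add: normal_density_pos)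

lemma prob_density_gauss_density:
  assumes "0 < \<sigma>"
  shows "prob_density lborel (gauss_density m \<sigma>)"
proof -
  have one: "(\<integral>\<^sup>+ z. ennreal (normal_density u \<sigma> z) \<partial>lborel) = 1" for u
    using assms by (subst nn_integral_eq_integral) auto
  have "(\<integral>\<^sup>+ y. ennreal (gauss_density m \<sigma> y) \<partial>lborel) =
      (\<integral>\<^sup>+ y. (\<Prod>b\<in>Basis. ennreal (normal_density (m \<bullet> b) \<sigma> (y \<bullet> b))) \<partial>lborel)"
    unfolding gauss_density_def by (simp add: prod_ennreal)
  also have "\<dots> = 1"
    by (subst nn_integral_lborel_prod[where f = "\<lambda>b z. ennreal (normal_density (m \<bullet> b) \<sigma> z)"])
       (simp_all add: one)
  finally have "(\<integral>\<^sup>+ y. ennreal (gauss_density m \<sigma> y) \<partial>lborel) = 1" .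
  moreover have "gauss_density m \<sigma> \<in> borel_measurable lborel"
    unfolding gauss_density_def[abs_def] by measurable
  ultimately show ?thesis
    using gauss_density_pos[OF assms] by (auto simp: prob_density_def intro: less_imp_le)
qed

lemma gauss_density_measurable:
  assumes [measurable]: "\<mu> \<in> borel_measurable borel"
  shows "(\<lambda>(y, x). gauss_density (\<mu> x) \<sigma> y) \<in> borel_measurable (borel \<Otimes>\<^sub>M borel)"
  unfolding gauss_density_def normal_density_def by measurable

lemma gauss_density_differentiable:
  assumes "\<mu> differentiable (at \<theta>)" and "0 < \<sigma>"
  shows "(\<lambda>\<theta>'. gauss_density (\<mu> \<theta>') \<sigma> y) differentiable (at \<theta>)"
proof -
  from assms obtain \<mu>' where [derivative_intros]: "(\<mu> has_derivative \<mu>') (at \<theta>)"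
    unfolding differentiable_def by blast
  show ?thesis
    unfolding gauss_density_def normal_density_def differentiable_def
    by (rule exI) (use assms in \<open>auto intro!: derivative_eq_intros\<close>)
qed

end

theory Submission
  imports Defs
begin

text \<open>
  Pointwise the two logarithmic ratios differ by $\log Z_{\mathcal A} - \mathcal A$, so near $\theta$
  the objective is $\int p_{\theta'}\,\mathcal A - \log Z_{\mathcal A}$; here one needs that the
  trajectory density has mass one, which follows by integrating out $x_0, x_1, \dots, x_T$ in turn.
  The local domination hypothesis allows differentiation under the integral, and the
  log-derivative trick turns $\nabla p_\theta$ into $p_\theta \sum_t \nabla \log p_\theta(x_{t-1} \mid x_t)$.
\<close>

section \<open>Total mass of a Markov trajectory density\<close>

text \<open>The chain runs from index \<open>T\<close> downwards, so the lowest coordinate occurs in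
  one factor only, as the freshly sampled argument of \<open>K (Suc k)\<close>. Integrating it out
  first removes that factor. The lower end \<open>k\<close> is kept variable because each
  integration raises it by one, down to the single coordinate \<open>T\<close>; the induction runs
  the opposite way. Nonnegative integrals let coordinates be split off without any integrability
  condition.\<close>

lemma nn_integral_PiM_markov:
  fixes M :: "'a measure" and u :: "'a \<Rightarrow> ennreal" and K :: "nat \<Rightarrow> 'a \<Rightarrow> 'a \<Rightarrow> ennreal"
  assumes M: "sigma_finite_measure M"
    and u [measurable]: "u \<in> borel_measurable M"
    and K: "\<And>t. t \<in> {Suc k..T} \<Longrightarrow> (\<lambda>(y, x). K t y x) \<in> borel_measurable (M \<Otimes>\<^sub>M M)"
    and K1: "\<And>t x. t \<in> {Suc k..T} \<Longrightarrow> x \<in> space M \<Longrightarrow> (\<integral>\<^sup>+ y. K t y x \<partial>M) = 1"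
    and "k \<le> T"
  shows "(\<integral>\<^sup>+ x. u (x T) * (\<Prod>t=Suc k..T. K t (x (t - 1)) (x t)) \<partial>(\<Pi>\<^sub>M t\<in>{k..T}. M))
    = (\<integral>\<^sup>+ z. u z \<partial>M)"
  using \<open>k \<le> T\<close> K K1
proof (induction k rule: inc_induct)
  interpret product_sigma_finite "\<lambda>_::nat. M"
    using M by (simp add: product_sigma_finite_def)
  case base
  show ?case by (simp add: product_nn_integral_singleton)
next
  interpret product_sigma_finite "\<lambda>_::nat. M"
    using M by (simp add: product_sigma_finite_def)
  case (step n)
  note K = step.prems(1) and K1 = step.prems(2)
  define F where "F k x = u (x T) * (\<Prod>t=Suc k..T. K t (x (t - 1)) (x t))" for k and x :: "nat \<Rightarrow> 'a"
  have K_comp: "(\<lambda>x. K t (x (t - 1)) (x t)) \<in> borel_measurable (\<Pi>\<^sub>M t\<in>{n..T}. M)"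
    if "t \<in> {Suc n..T}" for t
  proof -
    have "(\<lambda>x. (x (t - 1), x t)) \<in> (\<Pi>\<^sub>M t\<in>{n..T}. M) \<rightarrow>\<^sub>M M \<Otimes>\<^sub>M M"
      using that by (intro measurable_Pair measurable_component_singleton) auto
    from measurable_compose[OF this K[OF that]] show ?thesis by simp
  qed
  have ins: "{n..T} = insert n {Suc n..T}" using step.hyps by auto
  have F_meas: "F n \<in> borel_measurable (\<Pi>\<^sub>M t\<in>insert n {Suc n..T}. M)"
    unfolding F_def[abs_def] ins[symmetric] using step.hyps
    by (intro borel_measurable_times_ennreal borel_measurable_prod_ennreal K_comp
        measurable_compose[OF measurable_component_singleton[where i = T] u]) auto
  have "(\<integral>\<^sup>+ x. F n x \<partial>(\<Pi>\<^sub>M t\<in>{n..T}. M))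
      = (\<integral>\<^sup>+ x. (\<integral>\<^sup>+ y. F n (x(n := y)) \<partial>M) \<partial>(\<Pi>\<^sub>M t\<in>{Suc n..T}. M))"
    unfolding ins using F_meas by (subst product_nn_integral_insert) auto
  also have "\<dots> = (\<integral>\<^sup>+ x. F (Suc n) x \<partial>(\<Pi>\<^sub>M t\<in>{Suc n..T}. M))"
  proof (rule nn_integral_cong)
    fix x assume x: "x \<in> space (\<Pi>\<^sub>M t\<in>{Suc n..T}. M)"
    then have xn: "x (Suc n) \<in> space M" using step.hyps by (auto simp: space_PiM)
    \<comment> \<open>For \<open>t\<close> at least \<open>n + 2\<close> neither
      \<open>t - 1\<close> nor \<open>t\<close> equals \<open>n\<close>, and \<open>T\<close>
      differs from \<open>n\<close> because \<open>n < T\<close>. Hence the update at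
      \<open>n\<close> is visible only in the factor with index \<open>Suc n\<close>.\<close>
    have split: "F n (x(n := y)) = F (Suc n) x * K (Suc n) y (x (Suc n))" for y
    proof -
      have "{Suc n..T} = insert (Suc n) {Suc (Suc n)..T}" using step.hyps by auto
      moreover have "(\<Prod>t=Suc (Suc n)..T. K t ((x(n := y)) (t - 1)) ((x(n := y)) t))
          = (\<Prod>t=Suc (Suc n)..T. K t (x (t - 1)) (x t))"
        by (intro prod.cong) auto
      ultimately show ?thesis using step.hyps by (simp add: F_def mult_ac)
    qed
    have "(\<lambda>y. (y, x (Suc n))) \<in> M \<rightarrow>\<^sub>M M \<Otimes>\<^sub>M M" using xn by simp
    from measurable_compose[OF this K[of "Suc n"]]
    have "(\<lambda>y. K (Suc n) y (x (Suc n))) \<in> borel_measurable M" using step.hyps by simp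
    then show "(\<integral>\<^sup>+ y. F n (x(n := y)) \<partial>M) = F (Suc n) x"
      using K1[OF _ xn, of "Suc n"] step.hyps by (simp add: split nn_integral_cmult)
  qed
  also have "\<dots> = (\<integral>\<^sup>+ z. u z \<partial>M)"
    unfolding F_def using K K1 by (intro step.IH) auto
  finally show ?case unfolding F_def .
qed

section \<open>Measurability of gradients and differentiation under the integral\<close>

text \<open>Since \<open>grad\<close> is a definite description, measurability has to come from a
  limit: each coordinate of the gradient is the pointwise limit of difference quotients with steps
  1/(n+1), and these are measurable in \<open>x\<close>.\<close>

lemma borel_measurable_grad:
  fixes f :: "'q::euclidean_space \<Rightarrow> 'b \<Rightarrow> real"
  assumes meas: "\<And>\<theta>'. f \<theta>' \<in> borel_measurable M"
    and diff: "\<And>x. x \<in> space M \<Longrightarrow> (\<lambda>\<theta>'. f \<theta>' x) differentiable (at \<theta>)"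
  shows "(\<lambda>x. grad (\<lambda>\<theta>'. f \<theta>' x) \<theta>) \<in> borel_measurable M"
proof (rule borel_measurable_euclidean_space[THEN iffD2], rule ballI)
  fix b :: 'q assume "b \<in> Basis"
  let ?h = "\<lambda>n. inverse (real (Suc n))"
  show "(\<lambda>x. grad (\<lambda>\<theta>'. f \<theta>' x) \<theta> \<bullet> b) \<in> borel_measurable M"
  proof (rule borel_measurable_LIMSEQ_real)
    fix x assume "x \<in> space M"
    then have "(\<lambda>\<theta>'. f \<theta>' x) differentiable (at \<theta>)" by (rule diff)
    from GDERIV_grad[OF this]
    \<comment> \<open>The base point is written with \<open>0 *\<^sub>R b\<close> so that it is
      literally the value at 0 of the line through \<theta> in direction \<open>b\<close>, as the
      chain rule expects.\<close>
    have D: "((\<lambda>\<theta>'. f \<theta>' x) has_derivative (\<lambda>h. h \<bullet> grad (\<lambda>\<theta>'. f \<theta>' x) \<theta>)) (at (\<theta> + 0 *\<^sub>R b))"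
      by (simp add: gderiv_def)
    have "((\<lambda>s. \<theta> + s *\<^sub>R b) has_derivative (\<lambda>s. s *\<^sub>R b)) (at 0)"
      by (auto intro!: derivative_eq_intros)
    from has_derivative_compose[OF this D]
    have "((\<lambda>s. f (\<theta> + s *\<^sub>R b) x) has_real_derivative grad (\<lambda>\<theta>'. f \<theta>' x) \<theta> \<bullet> b) (at 0)"
      by (simp add: has_field_derivative_def inner_commute mult_commute_abs)
    then have "((\<lambda>s. (f (\<theta> + s *\<^sub>R b) x - f \<theta> x) / s) \<longlongrightarrow> grad (\<lambda>\<theta>'. f \<theta>' x) \<theta> \<bullet> b) (at 0)"
      by (simp add: DERIV_def)
    moreover have "filterlim ?h (at 0) sequentially"
      using LIMSEQ_inverse_real_of_nat by (simp add: filterlim_at)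
    ultimately show "(\<lambda>n. (f (\<theta> + ?h n *\<^sub>R b) x - f \<theta> x) / ?h n)
        \<longlonglongrightarrow> grad (\<lambda>\<theta>'. f \<theta>' x) \<theta> \<bullet> b"
      by (rule filterlim_compose)
  next
    fix n show "(\<lambda>x. (f (\<theta> + ?h n *\<^sub>R b) x - f \<theta> x) / ?h n) \<in> borel_measurable M"
      using meas by (intro borel_measurable_divide borel_measurable_diff) auto
  qed
qed

text \<open>The Leibniz rule for a parameter in a Euclidean space. The normalised first-order
  remainder of the integrand tends to 0 pointwise and is dominated by a multiple of
  \<open>g\<close>, so dominated convergence sends its integral to 0; that integral bounds the
  remainder of the integrated function.\<close>

lemma GDERIV_integral:
  fixes f :: "'q::euclidean_space \<Rightarrow> 'b \<Rightarrow> real" and G :: "'q \<Rightarrow> 'b \<Rightarrow> 'q"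
  assumes "r > 0"
    and int_f: "\<And>\<theta>'. \<theta>' \<in> ball \<theta> r \<Longrightarrow> integrable M (f \<theta>')"
    and int_g: "integrable M g"
    and deriv: "AE x in M. \<forall>\<theta>'\<in>ball \<theta> r. GDERIV (\<lambda>\<theta>''. f \<theta>'' x) \<theta>' :> G \<theta>' x"
    and bound: "AE x in M. \<forall>\<theta>'\<in>ball \<theta> r. norm (G \<theta>' x) \<le> g x"
    and G_meas: "G \<theta> \<in> borel_measurable M"
  shows "GDERIV (\<lambda>\<theta>'. \<integral>x. f \<theta>' x \<partial>M) \<theta> :> (\<integral>x. G \<theta> x \<partial>M)"
proof -
  let ?B = "ball \<theta> r"
  have \<theta>: "\<theta> \<in> ?B" using \<open>r > 0\<close> by simp
  have int_G: "integrable M (G \<theta>)"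
    by (rule Bochner_Integration.integrable_bound[OF int_g G_meas])
       (use bound in eventually_elim, use \<theta> in \<open>fastforce intro: order_trans\<close>)
  define Q where "Q y x = norm ((f y x - f \<theta> x) - (y - \<theta>) \<bullet> G \<theta> x) / norm (y - \<theta>)" for y x
  \<comment> \<open>One \<open>g\<close> bounds the increment of \<open>f\<close>, by the mean value
    inequality on the convex ball; the other bounds the linear term. Together they give the factor
    2.\<close>
  have Q_bound: "AE x in M. \<forall>y\<in>?B - {\<theta>}. Q y x \<le> 2 * g x"
    using deriv bound
  proof eventually_elim
    case (elim x)
    show ?case
    proof
      fix y assume y: "y \<in> ?B - {\<theta>}"
      have "norm (f y x - f \<theta> x) \<le> g x * norm (y - \<theta>)"
      proof (rule differentiable_bound[where f' = "\<lambda>\<theta>' h. h \<bullet> G \<theta>' x" and S = ?B])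
        fix z assume z: "z \<in> ?B"
        then show "((\<lambda>\<theta>''. f \<theta>'' x) has_derivative (\<lambda>h. h \<bullet> G z x)) (at z within ?B)"
          using elim(1) by (auto simp: gderiv_def intro: has_derivative_at_withinI)
        show "onorm (\<lambda>h. h \<bullet> G z x) \<le> g x"
        proof (rule onorm_le)
          fix h :: 'q
          have "norm (h \<bullet> G z x) \<le> norm h * norm (G z x)"
            by (simp add: Cauchy_Schwarz_ineq2)
          also have "\<dots> \<le> norm h * g x" using elim(2) z by (intro mult_left_mono) auto
          finally show "norm (h \<bullet> G z x) \<le> g x * norm h" by (simp add: mult.commute)
        qed
      qed (use y \<theta> in auto)
      moreover have "norm ((y - \<theta>) \<bullet> G \<theta> x) \<le> norm (y - \<theta>) * g x"
      proof -
        have "norm ((y - \<theta>) \<bullet> G \<theta> x) \<le> norm (y - \<theta>) * norm (G \<theta> x)"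
          by (simp add: Cauchy_Schwarz_ineq2)
        also have "\<dots> \<le> norm (y - \<theta>) * g x" using elim(2) \<theta> by (intro mult_left_mono) auto
        finally show ?thesis .
      qed
      ultimately have "norm ((f y x - f \<theta> x) - (y - \<theta>) \<bullet> G \<theta> x) \<le> 2 * g x * norm (y - \<theta>)"
        using norm_triangle_ineq4[of "f y x - f \<theta> x" "(y - \<theta>) \<bullet> G \<theta> x"] by (simp add: algebra_simps)
      then show "Q y x \<le> 2 * g x" using y by (simp add: Q_def divide_simps)
    qed
  qed
  \<comment> \<open>Working within the ball keeps every test point where integrability and the
    gradient bound are available. The ball is open, so the restriction is dropped at the
    end.\<close>
  have "((\<lambda>\<theta>'. \<integral>x. f \<theta>' x \<partial>M) has_derivative (\<lambda>h. h \<bullet> (\<integral>x. G \<theta> x \<partial>M))) (at \<theta> within ?B)"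
    unfolding has_derivative_iff_norm
  proof (intro conjI bounded_linear_inner_left)
    let ?R = "\<lambda>y. norm (((\<integral>x. f y x \<partial>M) - (\<integral>x. f \<theta> x \<partial>M)) - (y - \<theta>) \<bullet> (\<integral>x. G \<theta> x \<partial>M)) / norm (y - \<theta>)"
    show "(?R \<longlongrightarrow> 0) (at \<theta> within ?B)"
      \<comment> \<open>Dominated convergence is about sequences, so the limit is tested along
        arbitrary sequences in the punctured ball.\<close>
      unfolding tendsto_at_iff_sequentially
    proof (intro allI impI)
      fix X assume XB: "\<forall>i. X i \<in> ?B - {\<theta>}" and X: "X \<longlonglongrightarrow> \<theta>"
      have X_at: "filterlim X (at \<theta>) sequentially" using XB X by (auto simp: filterlim_at)
      have int_fX: "integrable M (f (X n))" for n using XB int_f by auto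
      have int_num: "integrable M (\<lambda>x. (f (X n) x - f \<theta> x) - (X n - \<theta>) \<bullet> G \<theta> x)" for n
        using int_fX int_f[OF \<theta>] int_G
        by (intro Bochner_Integration.integrable_diff integrable_inner_right) auto
      have int_Q: "integrable M (Q (X n))" for n
        unfolding Q_def[abs_def] by (intro integrable_divide integrable_norm int_num)
      have "(\<lambda>n. \<integral>x. Q (X n) x \<partial>M) \<longlonglongrightarrow> (\<integral>x. 0 \<partial>M)"
      proof (rule integral_dominated_convergence[where w = "\<lambda>x. 2 * g x"])
        show "AE x in M. (\<lambda>n. Q (X n) x) \<longlonglongrightarrow> 0"
          using deriv
        proof eventually_elim
          case (elim x)
          then have "((\<lambda>y. Q y x) \<longlongrightarrow> 0) (at \<theta>)"
            using \<theta> by (auto simp: gderiv_def has_derivative_iff_norm Q_def)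
          from filterlim_compose[OF this X_at] show ?case .
        qed
        show "AE x in M. norm (Q (X n) x) \<le> 2 * g x" for n
          using Q_bound by eventually_elim (use XB in \<open>auto simp: Q_def\<close>)
        show "Q (X n) \<in> borel_measurable M" for n using int_Q by auto
      qed (use int_g in auto)
      then have "(\<lambda>n. \<integral>x. Q (X n) x \<partial>M) \<longlonglongrightarrow> 0" by simp
      then show "(?R \<circ> X) \<longlonglongrightarrow> 0"
      proof (rule tendsto_0_le[where K = 1], intro always_eventually allI)
        fix n
        have "((\<integral>x. f (X n) x \<partial>M) - (\<integral>x. f \<theta> x \<partial>M)) - (X n - \<theta>) \<bullet> (\<integral>x. G \<theta> x \<partial>M)
            = (\<integral>x. (f (X n) x - f \<theta> x) - (X n - \<theta>) \<bullet> G \<theta> x \<partial>M)"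
          using int_fX int_f[OF \<theta>] int_G by simp
        then have "?R (X n) \<le> (\<integral>x. Q (X n) x \<partial>M)"
          unfolding Q_def by (simp add: divide_right_mono integral_norm_bound)
        then show "norm ((?R \<circ> X) n) \<le> norm (\<integral>x. Q (X n) x \<partial>M) * 1" by simp
      qed
    qed
  qed
  then show ?thesis
    unfolding gderiv_def using at_within_open[OF \<theta> open_ball] by simp
qed

section \<open>Logarithmic derivatives and exponentially tilted densities\<close>

lemma differentiable_ln:
  fixes f :: "'q::real_normed_vector \<Rightarrow> real"
  assumes "f differentiable (at \<theta>)" and "0 < f \<theta>"
  shows "(\<lambda>\<theta>'. ln (f \<theta>')) differentiable (at \<theta>)"
  using assms unfolding differentiable_def by (blast intro: has_derivative_ln)

text \<open>A product of positive functions is the exponential of the sum of their logarithms, and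
  the derivative of \<open>exp\<close> reproduces the product as a factor. Positivity at every
  parameter makes this an identity of functions, which may then be differentiated.\<close>

lemma GDERIV_prod_log:
  fixes f :: "'i \<Rightarrow> 'q::euclidean_space \<Rightarrow> real"
  assumes pos: "\<And>i \<theta>'. i \<in> I \<Longrightarrow> 0 < f i \<theta>'"
    and diff: "\<And>i. i \<in> I \<Longrightarrow> f i differentiable (at \<theta>)"
    and "finite I"
  shows "GDERIV (\<lambda>\<theta>'. \<Prod>i\<in>I. f i \<theta>') \<theta> :> (\<Prod>i\<in>I. f i \<theta>) *\<^sub>R (\<Sum>i\<in>I. grad (\<lambda>\<theta>'. ln (f i \<theta>')) \<theta>)"
proof -
  have eq: "(\<Prod>i\<in>I. f i \<theta>') = exp (\<Sum>i\<in>I. ln (f i \<theta>'))" for \<theta>'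
    using pos \<open>finite I\<close> by (simp add: exp_sum)
  have "((\<lambda>\<theta>'. ln (f i \<theta>')) has_derivative (\<lambda>h. h \<bullet> grad (\<lambda>\<theta>'. ln (f i \<theta>')) \<theta>)) (at \<theta>)"
    if i: "i \<in> I" for i
    using GDERIV_grad[OF differentiable_ln[OF diff[OF i] pos[OF i]]] by (simp add: gderiv_def)
  then have "GDERIV (\<lambda>\<theta>'. \<Sum>i\<in>I. ln (f i \<theta>')) \<theta> :> (\<Sum>i\<in>I. grad (\<lambda>\<theta>'. ln (f i \<theta>')) \<theta>)"
    unfolding gderiv_def inner_sum_right by (rule has_derivative_sum)
  from GDERIV_DERIV_compose[OF this DERIV_exp] show ?thesis by (simp add: eq)
qed

text \<open>Integrability of \<open>p x * a x\<close> is a conclusion: the function is a combination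
  of the two integrable divergence integrands and a multiple of \<open>p\<close>. The same pointwise
  identity, integrated with \<open>p\<close> of mass one, gives the second claim.\<close>

lemma minus_kl_div_tilted_plus_kl_div:
  fixes p q a :: "'b \<Rightarrow> real"
  assumes Z: "Z > 0"
    and p: "integrable M p" "(\<integral>x. p x \<partial>M) = 1" "\<And>x. x \<in> space M \<Longrightarrow> 0 \<le> p x"
    and q: "\<And>x. x \<in> space M \<Longrightarrow> 0 \<le> q x"
    and ac: "\<And>x. x \<in> space M \<Longrightarrow> q x = 0 \<Longrightarrow> p x = 0"
    and fin: "kl_finite M p (\<lambda>x. 1 / Z * q x * exp (a x))" "kl_finite M p q"
  shows "integrable M (\<lambda>x. p x * a x)"
    and "- kl_div M p (\<lambda>x. 1 / Z * q x * exp (a x)) + kl_div M p q = (\<integral>x. p x * a x \<partial>M) - ln Z"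
proof -
  let ?t = "\<lambda>x. 1 / Z * q x * exp (a x)"
  \<comment> \<open>Where \<open>p\<close> vanishes all terms are 0. Elsewhere \<open>ac\<close>
    forces \<open>q x > 0\<close>, so the logarithms of the quotients can be expanded.\<close>
  have pt: "p x * a x = p x * ln (p x / q x) - p x * ln (p x / ?t x) + p x * ln Z"
    if x: "x \<in> space M" for x
  proof (cases "p x = 0")
    case False
    then have "p x > 0" "q x > 0" using p(3)[OF x] q[OF x] ac[OF x] by (auto simp: less_le)
    then show ?thesis using Z by (simp add: ln_div ln_mult algebra_simps)
  qed simp
  have int: "integrable M (\<lambda>x. p x * ln (p x / q x) - p x * ln (p x / ?t x) + p x * ln Z)"
    using fin p(1) unfolding kl_finite_def
    by (intro Bochner_Integration.integrable_add Bochner_Integration.integrable_diff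
        integrable_mult_left)
  then show "integrable M (\<lambda>x. p x * a x)"
    by (rule Bochner_Integration.integrable_cong[THEN iffD1, rotated -1]) (simp_all add: pt)
  have "(\<integral>x. p x * a x \<partial>M) = (\<integral>x. p x * ln (p x / q x) - p x * ln (p x / ?t x) + p x * ln Z \<partial>M)"
    by (intro Bochner_Integration.integral_cong refl pt)
  also have "\<dots> = kl_div M p q - kl_div M p ?t + ln Z"
    unfolding kl_div_def using fin p(1,2) unfolding kl_finite_def
    by (subst Bochner_Integration.integral_add Bochner_Integration.integral_diff, simp_all)+
  finally show "- kl_div M p ?t + kl_div M p q = (\<integral>x. p x * a x \<partial>M) - ln Z" by simp
qed

section \<open>The policy gradient as the gradient of a difference of divergences\<close>

text \<open>Stating the result with \<open>GDERIV\<close> makes differentiability of the objective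
  part of the claim; the equation for \<open>grad\<close> follows by \<open>grad_eqI\<close>.
  Finiteness of both divergences near \<theta> ensures that \<open>kl_div\<close> there is a genuine
  integral and not the default value of a nonintegrable one.\<close>

theorem corollary1:
  fixes T :: nat
    and prior :: "'a::euclidean_space \<Rightarrow> real"
    and p :: "('q::euclidean_space, 'a, 'c) policy"
    and A :: "'a \<Rightarrow> 'c \<Rightarrow> real"
    and c :: 'c
    and \<theta> \<theta>old :: 'q
  assumes prior: "prob_density lborel prior"
    and trans_density:
      "\<And>\<theta>' t x. t \<in> {1..T} \<Longrightarrow> prob_density lborel (\<lambda>y. p \<theta>' t y x c)"
    and trans_measurable:
      "\<And>\<theta>' t. t \<in> {1..T} \<Longrightarrow> (\<lambda>(y, x). p \<theta>' t y x c) \<in> borel_measurable (borel \<Otimes>\<^sub>M borel)"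
    and trans_pos:
      "\<And>\<theta>' t y x. t \<in> {1..T} \<Longrightarrow> 0 < p \<theta>' t y x c"
    and trans_differentiable:
      "\<And>\<theta>' t y x. t \<in> {1..T} \<Longrightarrow> (\<lambda>\<theta>''. p \<theta>'' t y x c) differentiable (at \<theta>')"
    and advantage_measurable: "(\<lambda>x. A x c) \<in> borel_measurable borel"
    and partition_finite:
      "integrable (traj_space T) (\<lambda>x. traj_density T prior p c \<theta>old x * exp (A (x 0) c))"
    and kl_target_finite:
      "\<forall>\<^sub>F \<theta>' in nhds \<theta>. kl_finite (traj_space T)
         (traj_density T prior p c \<theta>') (target_density T prior p A c \<theta>old)"
    and kl_old_finite:
      "\<forall>\<^sub>F \<theta>' in nhds \<theta>. kl_finite (traj_space T)
         (traj_density T prior p c \<theta>') (traj_density T prior p c \<theta>old)"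
    and locally_dominated:
      "\<exists>r>0. \<exists>g. integrable (traj_space T) g \<and>
         (AE x in traj_space T. \<forall>\<theta>'\<in>ball \<theta> r.
            norm (traj_density T prior p c \<theta>' x *\<^sub>R reinforce_integrand T p A c \<theta>' x) \<le> g x)"
  shows "GDERIV (\<lambda>\<theta>'.
             - kl_div (traj_space T)
                 (traj_density T prior p c \<theta>') (target_density T prior p A c \<theta>old)
             + kl_div (traj_space T)
                 (traj_density T prior p c \<theta>') (traj_density T prior p c \<theta>old))
           \<theta> :> (policy_gradient T prior p A c \<theta>)"
proof -
  let ?M = "traj_space T :: (nat \<Rightarrow> 'a) measure"
  let ?q = "traj_density T prior p c"
  let ?G = "\<lambda>\<theta>' x. ?q \<theta>' x *\<^sub>R reinforce_integrand T p A c \<theta>' x"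
  let ?Z = "partition_const T prior p A c \<theta>old"
  have comp [measurable]: "(\<lambda>x. x t) \<in> borel_measurable ?M" if "t \<le> T" for t
    using measurable_component_singleton[of t "{0..T}" "\<lambda>_. lborel :: 'a measure"] that
    by (simp add: traj_space_def)
  have prior_meas: "prior \<in> borel_measurable borel" and prior_nonneg: "\<And>z. 0 \<le> prior z"
    and prior_one: "(\<integral>\<^sup>+ z. ennreal (prior z) \<partial>lborel) = 1"
    using prior by (auto simp: prob_density_def)
  have trans_meas: "(\<lambda>x. p \<theta>' t (x (t - 1)) (x t) c) \<in> borel_measurable ?M" if t: "t \<in> {1..T}" for \<theta>' t
  proof -
    have "(\<lambda>x. (x (t - 1), x t)) \<in> ?M \<rightarrow>\<^sub>M borel \<Otimes>\<^sub>M borel"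
      using t by (intro measurable_Pair comp) auto
    from measurable_compose[OF this trans_measurable[OF t]] show ?thesis by simp
  qed
  have q_meas: "?q \<theta>' \<in> borel_measurable ?M" for \<theta>'
    unfolding traj_density_def[abs_def]
    by (intro borel_measurable_times borel_measurable_prod trans_meas
        measurable_compose[OF comp prior_meas]) auto
  have trans_prod_pos: "0 < (\<Prod>t=1..T. p \<theta>' t (x (t - 1)) (x t) c)" for \<theta>' x
    by (intro prod_pos trans_pos) auto
  have q_nonneg: "0 \<le> ?q \<theta>' x" for \<theta>' x
    unfolding traj_density_def using prior_nonneg trans_prod_pos[of \<theta>' x] by (simp add: less_imp_le)
  \<comment> \<open>The prior alone decides where a trajectory density vanishes, so the zero set is
    the same for all parameters. This supplies the absolute continuity with respect to the old
    policy.\<close>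
  have q_zero_iff: "?q \<theta>' x = 0 \<longleftrightarrow> prior (x T) = 0" for \<theta>' x
    unfolding traj_density_def using trans_prod_pos[of \<theta>' x] by (metis less_irrefl mult_eq_0_iff)
  have q_one: "(\<integral>\<^sup>+ x. ennreal (?q \<theta>' x) \<partial>?M) = 1" for \<theta>'
  proof -
    have "(\<integral>\<^sup>+ x. ennreal (?q \<theta>' x) \<partial>?M)
        = (\<integral>\<^sup>+ x. ennreal (prior (x T)) * (\<Prod>t=Suc 0..T. ennreal (p \<theta>' t (x (t - 1)) (x t) c))
            \<partial>(\<Pi>\<^sub>M t\<in>{0..T}. lborel))"
      unfolding traj_density_def traj_space_def
    proof (rule nn_integral_cong)
      fix x :: "nat \<Rightarrow> 'a"
      have "(\<Prod>t=Suc 0..T. ennreal (p \<theta>' t (x (t - 1)) (x t) c))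
          = ennreal (\<Prod>t=1..T. p \<theta>' t (x (t - 1)) (x t) c)"
        by (subst prod_ennreal) (simp_all add: less_imp_le trans_pos)
      then show "ennreal (prior (x T) * (\<Prod>t=1..T. p \<theta>' t (x (t - 1)) (x t) c))
          = ennreal (prior (x T)) * (\<Prod>t=Suc 0..T. ennreal (p \<theta>' t (x (t - 1)) (x t) c))"
        using prior_nonneg trans_prod_pos[of \<theta>' x] by (simp add: ennreal_mult less_imp_le)
    qed
    also have "\<dots> = (\<integral>\<^sup>+ z. ennreal (prior z) \<partial>lborel)"
    proof (rule nn_integral_PiM_markov)
      show "(\<lambda>(y, x). ennreal (p \<theta>' t y x c)) \<in> borel_measurable (lborel \<Otimes>\<^sub>M lborel)"
        if "t \<in> {Suc 0..T}" for t
        using trans_measurable[of t \<theta>'] that by (simp add: split_beta' cong: measurable_cong_sets sets_pair_measure_cong)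
      show "(\<integral>\<^sup>+ y. ennreal (p \<theta>' t y x c) \<partial>lborel) = 1" if "t \<in> {Suc 0..T}" for t x
        using trans_density[of t \<theta>' x] that by (simp add: prob_density_def)
    qed (use prior_meas sigma_finite_lborel in auto)
    finally show ?thesis using prior_one by simp
  qed
  have q_int: "integrable ?M (?q \<theta>')" and q_integral: "(\<integral>x. ?q \<theta>' x \<partial>?M) = 1" for \<theta>'
    using q_one[of \<theta>'] q_meas[of \<theta>'] q_nonneg[of \<theta>']
    by (auto intro!: integrableI_nonneg simp: integral_eq_nn_integral)
  \<comment> \<open>The exponential never vanishes, so \<open>?Z = 0\<close> would make the old
    trajectory density zero almost everywhere, against its mass one.\<close>
  have Z_pos: "?Z > 0"
  proof -
    have "?Z \<noteq> 0"
    proof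
      assume "?Z = 0"
      then have "AE x in ?M. ?q \<theta>old x * exp (A (x 0) c) = 0"
        using integral_nonneg_eq_0_iff_AE[OF partition_finite] q_nonneg
        by (simp add: partition_const_def)
      then have "AE x in ?M. ?q \<theta>old x = 0" by simp
      then have "(\<integral>x. ?q \<theta>old x \<partial>?M) = 0" by (rule integral_eq_zero_AE)
      with q_integral show False by simp
    qed
    moreover have "?Z \<ge> 0"
      unfolding partition_const_def using q_nonneg by (intro Bochner_Integration.integral_nonneg) auto
    ultimately show ?thesis by simp
  qed
  have objective: "integrable ?M (\<lambda>x. ?q \<theta>' x * A (x 0) c)"
      "- kl_div ?M (?q \<theta>') (target_density T prior p A c \<theta>old) + kl_div ?M (?q \<theta>') (?q \<theta>old)
        = (\<integral>x. ?q \<theta>' x * A (x 0) c \<partial>?M) - ln ?Z"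
    if "kl_finite ?M (?q \<theta>') (target_density T prior p A c \<theta>old)" "kl_finite ?M (?q \<theta>') (?q \<theta>old)" for \<theta>'
    using minus_kl_div_tilted_plus_kl_div[of ?Z ?M "?q \<theta>'" "?q \<theta>old" "\<lambda>x. A (x 0) c"]
      Z_pos q_int q_integral q_nonneg that
    unfolding target_density_def[abs_def] by (simp_all add: q_zero_iff)
  have fin: "\<forall>\<^sub>F \<theta>' in nhds \<theta>. kl_finite ?M (?q \<theta>') (target_density T prior p A c \<theta>old)
      \<and> kl_finite ?M (?q \<theta>') (?q \<theta>old)"
    using kl_target_finite kl_old_finite by (rule eventually_conj)
  then obtain s where "s > 0" and s: "\<And>\<theta>'. \<theta>' \<in> ball \<theta> s \<Longrightarrow>
      kl_finite ?M (?q \<theta>') (target_density T prior p A c \<theta>old) \<and> kl_finite ?M (?q \<theta>') (?q \<theta>old)"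
    unfolding eventually_nhds_metric by (auto simp: dist_commute)
  obtain r g where "r > 0" and g: "integrable ?M g"
    and dom: "AE x in ?M. \<forall>\<theta>'\<in>ball \<theta> r. norm (?G \<theta>' x) \<le> g x"
    using locally_dominated by blast
  have ln_diff: "(\<lambda>\<theta>''. ln (p \<theta>'' t y x c)) differentiable (at \<theta>')" if t: "t \<in> {1..T}" for \<theta>' t y x
    by (rule differentiable_ln[OF trans_differentiable[OF t] trans_pos[OF t]])
  have score_meas: "reinforce_integrand T p A c \<theta> \<in> borel_measurable ?M"
    unfolding reinforce_integrand_def[abs_def]
    by (intro borel_measurable_sum borel_measurable_scaleR measurable_compose[OF comp advantage_measurable]
        borel_measurable_grad borel_measurable_ln trans_meas ln_diff) auto
  \<comment> \<open>The prior and the advantage are constants in the parameter. Logarithms are taken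
    of the transitions only, so trajectories with zero prior density need no separate case.\<close>
  have deriv: "GDERIV (\<lambda>\<theta>''. ?q \<theta>'' x * A (x 0) c) \<theta>' :> ?G \<theta>' x" for \<theta>' x
  proof -
    have "GDERIV (\<lambda>\<theta>''. \<Prod>t=1..T. p \<theta>'' t (x (t - 1)) (x t) c) \<theta>' :>
        (\<Prod>t=1..T. p \<theta>' t (x (t - 1)) (x t) c) *\<^sub>R
          (\<Sum>t=1..T. grad (\<lambda>\<theta>''. ln (p \<theta>'' t (x (t - 1)) (x t) c)) \<theta>')"
      by (rule GDERIV_prod_log) (simp_all add: trans_pos trans_differentiable)
    from GDERIV_mult[OF GDERIV_const[of "prior (x T) * A (x 0) c"] this]
    show ?thesis
      by (simp add: traj_density_def reinforce_integrand_def scaleR_sum_right[symmetric] mult_ac)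
  qed
  have "GDERIV (\<lambda>\<theta>'. \<integral>x. ?q \<theta>' x * A (x 0) c \<partial>?M) \<theta> :> (\<integral>x. ?G \<theta> x \<partial>?M)"
  \<comment> \<open>Domination holds on the ball of radius \<open>r\<close>; on that of radius
    \<open>s\<close> both divergences are finite, whence the integrand is integrable by
    \<open>objective\<close>.\<close>
  proof (rule GDERIV_integral[where r = "min r s" and g = g])
    show "AE x in ?M. \<forall>\<theta>'\<in>ball \<theta> (min r s). norm (?G \<theta>' x) \<le> g x"
      using dom by eventually_elim auto
    show "?G \<theta> \<in> borel_measurable ?M"
      by (intro borel_measurable_scaleR q_meas score_meas)
  qed (use \<open>r > 0\<close> \<open>s > 0\<close> g s deriv objective(1) in auto)
  also have "(\<integral>x. ?G \<theta> x \<partial>?M) = policy_gradient T prior p A c \<theta>"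
    unfolding policy_gradient_def using score_meas q_meas q_nonneg
    by (subst integral_density) auto
  finally have "GDERIV (\<lambda>\<theta>'. (\<integral>x. ?q \<theta>' x * A (x 0) c \<partial>?M) - ln ?Z) \<theta> :>
      policy_gradient T prior p A c \<theta>"
    using GDERIV_diff[OF _ GDERIV_const[of "ln ?Z"]] by fastforce
  \<comment> \<open>The objective is known to equal the expected advantage minus
    \<open>ln ?Z\<close> only near \<theta>, so the derivative is transferred by eventual equality
    together with equality at \<theta> itself.\<close>
  then show ?thesis
    unfolding gderiv_def
  proof (rule has_derivative_transform_eventually)
    show "\<forall>\<^sub>F \<theta>' in at \<theta>. (\<integral>x. ?q \<theta>' x * A (x 0) c \<partial>?M) - ln ?Z
        = - kl_div ?M (?q \<theta>') (target_density T prior p A c \<theta>old) + kl_div ?M (?q \<theta>') (?q \<theta>old)"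
      using fin objective(2) by (auto simp: eventually_at_filter elim!: eventually_mono)
    show "(\<integral>x. ?q \<theta> x * A (x 0) c \<partial>?M) - ln ?Z
        = - kl_div ?M (?q \<theta>) (target_density T prior p A c \<theta>old) + kl_div ?M (?q \<theta>) (?q \<theta>old)"
      using objective(2) eventually_nhds_x_imp_x[OF fin] by auto
  qed simp
qed

end
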